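(* For every $t\geq 2$ and every $n\geq 2$, $\lambda(M^t(K_n))=2^t(n+1)-2$.
   Context: $K_n$ is the complete graph on $n$ vertices. An $L(2,1)$-labeling of $G$ is a map $f:V\to\{0,1,2,\dots\}$ with $|f(x)-f(y)|\ge 2$ if $d_G(x,y)=1$ and $|f(x)-f(y)|\ge1$ if $d_G(x,y)=2$; $\lambda(G)$ is the minimum over such $f$ of the largest label. For $V=\{v_1,\dots,v_n\}$, $M(G)$ has vertex set $V\cup\{v_1',\dots,v_n'\}\cup\{u\}$ and edge set $E\cup\{v_iv_j' : v_iv_j\in E\}\cup\{v_i'u: 1\le i\le n\}$; $M^0(G)=G$ and $M^t(G)=M(M^{t-1}(G))$. *)

theory Defs
  imports "Graph_Theory.Graph_Theory"
begin

text \<open>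
  Simple undirected graphs are the \<^locale>\<open>pair_graph\<close>s, in which an edge
  \<open>xy\<close> is the pair of arcs \<open>(x, y)\<close> and \<open>(y, x)\<close>.
\<close>

definition gdist :: "'a pair_pre_digraph \<Rightarrow> 'a \<Rightarrow> 'a \<Rightarrow> ereal" where
  "gdist G = wf_digraph.\<mu> (with_proj G) (\<lambda>_. 1)"

definition L21_labeling :: "'a pair_pre_digraph \<Rightarrow> ('a \<Rightarrow> nat) \<Rightarrow> bool" where
  "L21_labeling G f \<longleftrightarrow>
     (\<forall>x \<in> pverts G. \<forall>y \<in> pverts G.
        (gdist G x y = 1 \<longrightarrow> \<bar>int (f x) - int (f y)\<bar> \<ge> 2) \<and>
        (gdist G x y = 2 \<longrightarrow> \<bar>int (f x) - int (f y)\<bar> \<ge> 1))"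

definition L21_number :: "'a pair_pre_digraph \<Rightarrow> nat" where
  "L21_number G = (LEAST k. \<exists>f. L21_labeling G f \<and> k = Max (f ` pverts G))"

text \<open>
  The Mycielskian adds a copy of every vertex and one apex, so its iteration needs a vertex type
  that is closed under these operations. \<open>Orig v\<close> is the vertex \<open>v\<close> of \<open>G\<close> regarded as a vertex
  of \<open>M(G)\<close>, \<open>Copy v\<close> is \<open>v'\<close> and \<open>Apex\<close> is \<open>u\<close>. The three kinds are disjoint whatever the
  vertices of \<open>G\<close> are; \<open>Base\<close> embeds an arbitrary type of vertices for the initial graph.
\<close>

datatype 'a mvert = Base 'a | Orig "'a mvert" | Copy "'a mvert" | Apex

definition mycielskian :: "'a mvert pair_pre_digraph \<Rightarrow> 'a mvert pair_pre_digraph" where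
  "mycielskian G = \<lparr>
     pverts = Orig ` pverts G \<union> Copy ` pverts G \<union> {Apex},
     parcs = {(Orig x, Orig y) | x y. (x, y) \<in> parcs G}
       \<union> {(Orig x, Copy y) | x y. (x, y) \<in> parcs G}
       \<union> {(Copy y, Orig x) | x y. (x, y) \<in> parcs G}
       \<union> {(Copy x, Apex) | x. x \<in> pverts G}
       \<union> {(Apex, Copy x) | x. x \<in> pverts G} \<rparr>"

lemma pair_graph_mycielskian:
  assumes "pair_graph G"
  shows "pair_graph (mycielskian G)"
proof -
  interpret pair_graph G by fact
  have s: "(y, x) \<in> parcs G" if "(x, y) \<in> parcs G" for x y
    using pair_sym_arcs that by (auto simp: symmetric_def dest: symD)
  have w: "x \<in> pverts G" "y \<in> pverts G" "x \<noteq> y" if "(x, y) \<in> parcs G" for x y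
    using that pair_no_loops[OF that] by (auto dest: wellformed')
  let ?V = "pverts (mycielskian G)"
  have fv: "finite ?V"
    using pair_finite_verts by (simp add: mycielskian_def)
  have "parcs (mycielskian G) \<subseteq> ?V \<times> ?V"
    by (auto simp: mycielskian_def dest: w)
  then have fa: "finite (parcs (mycielskian G))"
    using fv by (meson finite_SigmaI finite_subset)
  show ?thesis
    by unfold_locales
      (use fv fa in \<open>auto simp: mycielskian_def symmetric_def intro!: symI dest: w s\<close>)
qed

end

theory Submission
  imports Defs
begin

text \<open>
  In a graph of diameter at most 2 all labels are distinct, so \<open>\<lambda>\<close> is at least the number of
  vertices minus 1, and equality holds as soon as the complement has a Hamiltonian path, along
  which the vertices can be labelled consecutively. The Mycielskian preserves diameter at most 2
  in the absence of isolated vertices, and \<open>M\<^sup>t(K\<^sub>n)\<close> has \<open>2\<^sup>t(n + 1) - 1\<close> vertices.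

  In the complement of \<open>M(G)\<close> the copies form a clique, every \<open>v\<close> is joined to \<open>v'\<close>, and \<open>u\<close> is
  joined to every original vertex. A Hamiltonian path \<open>x\<^sub>1, \<dots>, x\<^sub>m\<close> of the complement of \<open>G\<close>
  therefore extends to the path \<open>u, x\<^sub>1, \<dots>, x\<^sub>m, x\<^sub>m', \<dots>, x\<^sub>1'\<close>. For \<open>M\<^sup>2(G)\<close> no assumption
  on \<open>G\<close> is needed: concatenate the pieces \<open>c(v), v, c(v')\<close> over all vertices \<open>v\<close> of \<open>G\<close>, where \<open>'\<close>
  denotes the copy in \<open>M(G)\<close> and \<open>c\<close> the copy in \<open>M\<^sup>2(G)\<close>; continue with \<open>c(u)\<close>, \<open>u\<close>, the apex of
  \<open>M\<^sup>2(G)\<close>, and finally all \<open>v'\<close>.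
\<close>

section \<open>Distances one and two in terms of arcs\<close>

context pair_graph
begin

lemma gdist_refl_le: "x \<in> pverts G \<Longrightarrow> gdist G x x \<le> 0"
  unfolding gdist_def
  using min_cost_le_walk_cost[of x "[]" x "\<lambda>_. 1"] by (simp add: awalk_Nil_iff zero_ereal_def)

lemma gdist_arc_le: "(x, y) \<in> parcs G \<Longrightarrow> gdist G x y \<le> 1"
  unfolding gdist_def
  using min_cost_le_walk_cost[of x "[(x, y)]" y "\<lambda>_. 1"]
  by (simp add: awalk_simps wellformed' one_ereal_def)

lemma gdist_two_arcs_le:
  "(x, z) \<in> parcs G \<Longrightarrow> (z, y) \<in> parcs G \<Longrightarrow> gdist G x y \<le> 2"
  unfolding gdist_def
  using min_cost_le_walk_cost[of x "[(x, z), (z, y)]" y "\<lambda>_. 1"]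
  by (simp add: awalk_simps wellformed')

lemma gdist_ge_1: "x \<noteq> y \<Longrightarrow> 1 \<le> gdist G x y"
  unfolding gdist_def \<mu>_def
proof (rule INF_greatest)
  fix p assume "x \<noteq> y" "p \<in> {p. awalk x p y}"
  then show "1 \<le> ereal (awalk_cost (\<lambda>_. 1) p)"
    by (cases p) (auto simp: awalk_simps awalk_cost_def sum_list_triv)
qed

lemma gdist_ge_2:
  assumes "x \<noteq> y" "(x, y) \<notin> parcs G"
  shows "2 \<le> gdist G x y"
  unfolding gdist_def \<mu>_def
proof (rule INF_greatest)
  fix p assume "p \<in> {p. awalk x p y}"
  \<comment> \<open>The empty walk would force \<open>x = y\<close>, and a walk with one arc would
    be the excluded arc.\<close>
  then have "length p \<ge> 2"
    using assms by (cases p; cases "tl p") (auto simp: awalk_simps)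
  then show "2 \<le> ereal (awalk_cost (\<lambda>_. 1) p)"
    by (simp add: awalk_cost_def sum_list_triv)
qed

lemma gdist_eq_1_iff:
  assumes "x \<in> pverts G"
  shows "gdist G x y = 1 \<longleftrightarrow> (x, y) \<in> parcs G"
proof
  assume d: "gdist G x y = 1"
  then have "x \<noteq> y"
    using gdist_refl_le[OF assms] by auto
  with d show "(x, y) \<in> parcs G"
    using gdist_ge_2[of x y] by fastforce
next
  assume "(x, y) \<in> parcs G"
  then show "gdist G x y = 1"
    using gdist_arc_le gdist_ge_1 pair_no_loops by (metis antisym fst_conv snd_conv)
qed

lemma gdist_2_imp_neq: "x \<in> pverts G \<Longrightarrow> gdist G x y = 2 \<Longrightarrow> x \<noteq> y"
  using gdist_refl_le by force

lemma gdist_eq_2I: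
  "x \<noteq> y \<Longrightarrow> (x, y) \<notin> parcs G \<Longrightarrow> (x, z) \<in> parcs G \<Longrightarrow> (z, y) \<in> parcs G \<Longrightarrow> gdist G x y = 2"
  using gdist_two_arcs_le gdist_ge_2 by (metis antisym)

end

section \<open>Labelings and Hamiltonian paths of the complement\<close>

definition diam_le_2 :: "'a pair_pre_digraph \<Rightarrow> bool" where
  "diam_le_2 G \<longleftrightarrow> (\<forall>x \<in> pverts G. \<forall>y \<in> pverts G.
     x = y \<or> (x, y) \<in> parcs G \<or> (\<exists>z. (x, z) \<in> parcs G \<and> (z, y) \<in> parcs G))"

definition no_isolated :: "'a pair_pre_digraph \<Rightarrow> bool" where
  "no_isolated G \<longleftrightarrow> (\<forall>x \<in> pverts G. \<exists>z. (x, z) \<in> parcs G)"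

text \<open>A Hamiltonian path of the complement graph, kept as a list so that positions can serve
  as labels.\<close>

definition co_ham_path :: "'a pair_pre_digraph \<Rightarrow> 'a list \<Rightarrow> bool" where
  "co_ham_path G xs \<longleftrightarrow>
     distinct xs \<and> set xs = pverts G \<and> successively (\<lambda>x y. (x, y) \<notin> parcs G) xs"

lemma L21_labeling_inj_on:
  assumes "pair_graph G" "diam_le_2 G" "L21_labeling G f"
  shows "inj_on f (pverts G)"
proof (rule inj_onI, rule ccontr)
  interpret pair_graph G by fact
  fix x y assume xy: "x \<in> pverts G" "y \<in> pverts G" "f x = f y" "x \<noteq> y"
  then have "gdist G x y = 1 \<or> gdist G x y = 2"
    using assms(2) gdist_eq_1_iff gdist_eq_2I unfolding diam_le_2_def by metis
  with xy show False
    using assms(3) unfolding L21_labeling_def by fastforce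
qed

lemma L21_labeling_Max_ge:
  assumes "pair_graph G" "diam_le_2 G" "L21_labeling G f"
  shows "card (pverts G) - 1 \<le> Max (f ` pverts G)"
proof -
  interpret pair_graph G by fact
  have "card (pverts G) = card (f ` pverts G)"
    using L21_labeling_inj_on[OF assms] by (simp add: card_image)
  also have "\<dots> \<le> card {..Max (f ` pverts G)}"
    using pair_finite_verts by (intro card_mono) auto
  finally show ?thesis by simp
qed

lemma L21_labeling_of_co_ham_path:
  assumes "pair_graph G" "co_ham_path G xs" "pverts G \<noteq> {}"
  shows "\<exists>f. L21_labeling G f \<and> card (pverts G) - 1 = Max (f ` pverts G)"
proof -
  interpret pair_graph G by fact
  have d: "distinct xs" and V: "set xs = pverts G"
    and succ: "\<And>i. Suc i < length xs \<Longrightarrow> (xs ! i, xs ! Suc i) \<notin> parcs G"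
    using assms(2) by (auto simp: co_ham_path_def successively_conv_nth)
  have sym: "(x, y) \<in> parcs G \<Longrightarrow> (y, x) \<in> parcs G" for x y
    using pair_sym_arcs by (auto simp: symmetric_def dest: symD)
  have bij: "bij_betw ((!) xs) {..<length xs} (pverts G)"
    using bij_betw_nth[OF d] V by simp
  \<comment> \<open>\<open>f x\<close> is the position of \<open>x\<close> in \<open>xs\<close>,
    counted from 0, so the largest label is the number of vertices minus 1.\<close>
  define f where "f = the_inv_into {..<length xs} ((!) xs)"
  have f: "f x < length xs" "xs ! f x = x" if "x \<in> pverts G" for x
    using bij_betwE[OF bij_betw_the_inv_into[OF bij]] f_the_inv_into_f_bij_betw[OF bij] that
    by (auto simp: f_def)
  have inj: "f x \<noteq> f y" if "x \<in> pverts G" "y \<in> pverts G" "x \<noteq> y" for x y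
    using f that by metis
  have "L21_labeling G f"
    unfolding L21_labeling_def
  proof (intro ballI conjI impI)
    fix x y assume xy: "x \<in> pverts G" "y \<in> pverts G"
    {
      assume "gdist G x y = 2"
      then show "1 \<le> \<bar>int (f x) - int (f y)\<bar>"
        using inj[of x y] gdist_2_imp_neq xy by force
    next
      assume "gdist G x y = 1"
      then have a: "(x, y) \<in> parcs G"
        using xy gdist_eq_1_iff by blast
      then have "f x \<noteq> f y"
        using inj[of x y] xy pair_no_loops[OF a] by auto
      \<comment> \<open>Consecutive entries of \<open>xs\<close> are nonadjacent; both orders must
        be excluded before the gap is at least 2.\<close>
      moreover have "f y \<noteq> Suc (f x)"
        using succ[of "f x"] f[OF xy(1)] f[OF xy(2)] a by metis
      moreover have "f x \<noteq> Suc (f y)"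
        using succ[of "f y"] f[OF xy(1)] f[OF xy(2)] sym[OF a] by metis
      ultimately show "2 \<le> \<bar>int (f x) - int (f y)\<bar>" by linarith
    }
  qed
  moreover have "f ` pverts G = {..<length xs}"
    using bij_betw_the_inv_into[OF bij] by (simp add: f_def bij_betw_def)
  moreover have "Max {..<length xs} = card (pverts G) - 1"
    using assms(3) V[symmetric] distinct_card[OF d] by (intro Max_eqI) auto
  ultimately show ?thesis by metis
qed

lemma L21_number_eq_card:
  assumes "pair_graph G" "diam_le_2 G" "co_ham_path G xs" "pverts G \<noteq> {}"
  shows "L21_number G = card (pverts G) - 1"
  unfolding L21_number_def
  using L21_labeling_of_co_ham_path[OF assms(1,3,4)] L21_labeling_Max_ge[OF assms(1,2)]
  by (intro Least_equality) auto

section \<open>One and two Mycielskian steps\<close>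

lemma pverts_mycielskian:
  "pverts (mycielskian G) = Orig ` pverts G \<union> Copy ` pverts G \<union> {Apex}"
  by (simp add: mycielskian_def)

lemma parcs_mycielskian_iff [simp]:
  "(Orig x, Orig y) \<in> parcs (mycielskian G) \<longleftrightarrow> (x, y) \<in> parcs G"
  "(Orig x, Copy y) \<in> parcs (mycielskian G) \<longleftrightarrow> (x, y) \<in> parcs G"
  "(Copy x, Orig y) \<in> parcs (mycielskian G) \<longleftrightarrow> (y, x) \<in> parcs G"
  "(Copy x, Copy y) \<notin> parcs (mycielskian G)"
  "(Copy x, Apex) \<in> parcs (mycielskian G) \<longleftrightarrow> x \<in> pverts G"
  "(Apex, Copy x) \<in> parcs (mycielskian G) \<longleftrightarrow> x \<in> pverts G"
  "(Orig x, Apex) \<notin> parcs (mycielskian G)"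
  "(Apex, Orig x) \<notin> parcs (mycielskian G)"
  by (auto simp: mycielskian_def)

lemma card_pverts_mycielskian:
  assumes "finite (pverts G)"
  shows "card (pverts (mycielskian G)) = 2 * card (pverts G) + 1"
proof -
  have "card (Orig ` pverts G \<union> Copy ` pverts G) = card (pverts G) + card (pverts G)"
    using assms by (subst card_Un_disjoint) (auto simp: card_image inj_on_def)
  then show ?thesis
    using assms by (subst pverts_mycielskian, subst card_Un_disjoint) auto
qed

context
  fixes G :: "'a mvert pair_pre_digraph"
  assumes graph: "pair_graph G"
begin

interpretation pair_graph G by (fact graph)

lemma parcs_sym: "(x, y) \<in> parcs G \<Longrightarrow> (y, x) \<in> parcs G"
  using pair_sym_arcs by (auto simp: symmetric_def dest: symD)

lemma no_isolated_mycielskian: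
  assumes "no_isolated G" "pverts G \<noteq> {}"
  shows "no_isolated (mycielskian G)"
  using assms unfolding no_isolated_def pverts_mycielskian
  by (metis (no_types, lifting) UnE imageE parcs_mycielskian_iff(1,5,6) singletonD equals0I)

text \<open>Paths of length two lift with an original middle vertex. A neighbour \<open>z\<close> of
  \<open>x\<close> links \<open>Orig x\<close> to \<open>Copy x\<close> through
  \<open>Orig z\<close>, and to \<open>Apex\<close> through \<open>Copy z\<close>; this is where
  \<open>no_isolated\<close> enters. Any two copies meet in \<open>Apex\<close>.\<close>

lemma diam_le_2_mycielskian:
  assumes iso: "no_isolated G" and diam: "diam_le_2 G"
  shows "diam_le_2 (mycielskian G)"
proof -
  let ?A = "parcs (mycielskian G)"
  let ?near = "\<lambda>x y. x = y \<or> (x, y) \<in> ?A \<or> (\<exists>z. (x, z) \<in> ?A \<and> (z, y) \<in> ?A)"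
  have nb: "\<exists>z. (x, z) \<in> parcs G" if "x \<in> pverts G" for x
    using iso that by (simp add: no_isolated_def)
  have near: "x = y \<or> (x, y) \<in> parcs G \<or> (\<exists>z. (x, z) \<in> parcs G \<and> (z, y) \<in> parcs G)"
    if "x \<in> pverts G" "y \<in> pverts G" for x y
    using diam that unfolding diam_le_2_def by blast
  have OO: "?near (Orig x) (Orig y)" if "x \<in> pverts G" "y \<in> pverts G" for x y
    using near[OF that] by (metis parcs_mycielskian_iff(1))
  have OC: "?near (Orig x) (Copy y)" if "x \<in> pverts G" "y \<in> pverts G" for x y
    using near[OF that] nb[OF that(1)] parcs_sym by (metis parcs_mycielskian_iff(1,2))
  have CO: "?near (Copy y) (Orig x)" if "x \<in> pverts G" "y \<in> pverts G" for x y
    using near[OF that] nb[OF that(1)] parcs_sym by (metis parcs_mycielskian_iff(1,3))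
  have CC: "?near (Copy x) (Copy y)" if "x \<in> pverts G" "y \<in> pverts G" for x y
    using that by (metis parcs_mycielskian_iff(5,6))
  have OA: "?near (Orig x) Apex" if "x \<in> pverts G" for x
    using nb[OF that] in_arcsD2 by (metis parcs_mycielskian_iff(2,5))
  have AO: "?near Apex (Orig x)" if "x \<in> pverts G" for x
    using nb[OF that] in_arcsD2 parcs_sym by (metis parcs_mycielskian_iff(3,6))
  have CA: "?near (Copy x) Apex" "?near Apex (Copy x)" if "x \<in> pverts G" for x
    using that by simp_all
  show ?thesis
    unfolding diam_le_2_def pverts_mycielskian
    using OO OC CO CC OA AO CA by blast
qed

lemma co_ham_path_mycielskian:
  assumes "co_ham_path G xs"
  shows "co_ham_path (mycielskian G) (Apex # map Orig xs @ map Copy (rev xs))"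
proof -
  have "successively (\<lambda>x y. (Copy x, Copy y) \<notin> parcs (mycielskian G)) (rev xs)"
    by (simp add: successively_conv_nth)
  \<comment> \<open>The path turns from \<open>Orig (last xs)\<close> to
    \<open>Copy (last xs)\<close>; an arc there would come from a loop of \<open>G\<close>.\<close>
  then show ?thesis
    using assms pair_no_loops[of "(last xs, last xs)"]
    by (cases "xs = []")
      (auto simp: co_ham_path_def pverts_mycielskian distinct_map inj_on_def successively_Cons
        successively_append_iff successively_map hd_map last_map hd_rev hd_append
        simp del: successively_rev)
qed

lemma co_ham_path_mycielskian_twice:
  "\<exists>xs. co_ham_path (mycielskian (mycielskian G)) xs"
proof -
  obtain vs where vs: "set vs = pverts G" "distinct vs"
    using finite_distinct_list[OF pair_finite_verts] by blast
  let ?P = "\<lambda>x y. (x, y) \<notin> parcs (mycielskian (mycielskian G))"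
  define segs where "segs = concat \<circ>
    map (\<lambda>v. [Copy (Orig v), Orig (Orig v), Copy (Copy v)] :: 'a mvert list)"
  define ys where "ys = Orig Apex # Apex # map (\<lambda>v. Orig (Copy v)) vs"
  have loop: "(v, v) \<notin> parcs G" for v
    using pair_no_loops[of "(v, v)"] by auto
  have "successively ?P (map (\<lambda>v. Orig (Copy v)) vs)"
    by (simp add: successively_conv_nth)
  \<comment> \<open>\<open>Copy Apex\<close> and \<open>Orig Apex\<close> are nonadjacent since
    \<open>Apex\<close> has no loop in \<open>mycielskian G\<close>, and the new \<open>Apex\<close>
    is adjacent to copies only.\<close>
  then have ys: "successively ?P (Copy Apex # ys)"
    by (cases vs) (simp_all add: ys_def mycielskian_def)
  have "successively ?P (segs ws @ Copy Apex # ys)" for ws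
  proof (induction ws)
    case (Cons w ws)
    \<comment> \<open>Each piece ends in a copy and whatever follows it starts with one, so the
      junction is never an arc.\<close>
    moreover have "\<exists>z zs. segs ws @ Copy Apex # ys = Copy z # zs"
      by (cases ws) (simp_all add: segs_def)
    ultimately show ?case
      by (auto simp: segs_def loop)
  qed (simp add: segs_def ys)
  moreover have "set (segs vs @ Copy Apex # ys) = pverts (mycielskian (mycielskian G))"
    using vs(1) by (auto simp: segs_def ys_def pverts_mycielskian)
  moreover have "distinct (segs ws)" if "distinct ws" for ws
    using that by (induction ws) (auto simp: segs_def)
  then have "distinct (segs vs @ Copy Apex # ys)"
    using vs(2) by (auto simp: segs_def ys_def distinct_map inj_on_def)
  ultimately show ?thesis
    unfolding co_ham_path_def by blast
qed

end

section \<open>Iteration and the complete graph\<close>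

lemma iterated_mycielskian:
  assumes "pair_graph G" "no_isolated G" "diam_le_2 G" "pverts G \<noteq> {}"
  shows "pair_graph ((mycielskian ^^ t) G) \<and> no_isolated ((mycielskian ^^ t) G)
    \<and> diam_le_2 ((mycielskian ^^ t) G) \<and> pverts ((mycielskian ^^ t) G) \<noteq> {}
    \<and> card (pverts ((mycielskian ^^ t) G)) + 1 = 2 ^ t * (card (pverts G) + 1)"
proof (induction t)
  case (Suc t)
  let ?H = "(mycielskian ^^ t) G"
  interpret H: pair_graph ?H using Suc by blast
  \<comment> \<open>From \<open>m\<close> vertices a step makes \<open>2 * m + 1\<close>, so the
    count plus 1 doubles. Nonemptiness is carried along to give each new apex a neighbour.\<close>
  show ?case
    using Suc pair_graph_mycielskian[of ?H] no_isolated_mycielskian[of ?H]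
      diam_le_2_mycielskian[of ?H] card_pverts_mycielskian[OF H.pair_finite_verts]
    by (simp add: pverts_mycielskian)
qed (use assms in simp)

text \<open>The induction starts after two steps, as the complement of a complete graph has no edges
  to build a path from.\<close>

lemma co_ham_path_iterated_mycielskian:
  assumes "pair_graph G"
  shows "\<exists>xs. co_ham_path ((mycielskian ^^ (t + 2)) G) xs"
proof (induction t)
  case 0
  then show ?case
    using co_ham_path_mycielskian_twice[OF assms] by (simp add: numeral_2_eq_2)
next
  case (Suc t)
  have "pair_graph ((mycielskian ^^ s) G)" for s
    by (induction s) (use assms pair_graph_mycielskian in auto)
  with Suc show ?case
    using co_ham_path_mycielskian by (metis add_Suc comp_apply funpow.simps(2))
qed

theorem theorem4p2:
  fixes G :: "'a mvert pair_pre_digraph" and n t :: nat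
  assumes "t \<ge> 2" and "n \<ge> 2" and "complete_digraph n (with_proj G)"
  shows "L21_number ((mycielskian ^^ t) G) = 2 ^ t * (n + 1) - 2"
proof -
  let ?H = "(mycielskian ^^ t) G"
  have card: "card (pverts G) = n"
    and arcs: "\<And>x y. (x, y) \<in> parcs G \<longleftrightarrow> x \<in> pverts G \<and> y \<in> pverts G \<and> x \<noteq> y"
    using assms(3) by (auto simp: complete_digraph_pair_def)
  have graph: "pair_graph G"
    using assms(3) by (rule pair_graphI_complete)
  have diam: "diam_le_2 G"
    by (auto simp: diam_le_2_def arcs)
  \<comment> \<open>As \<open>x\<close> ranges over the whole type, this also shows that
    \<open>G\<close> has a vertex.\<close>
  have "\<exists>z \<in> pverts G. z \<noteq> x" for x
  proof (rule ccontr)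
    assume "\<not> ?thesis"
    then have "pverts G \<subseteq> {x}" by blast
    then have "card (pverts G) \<le> 1"
      using card_mono[of "{x}"] by fastforce
    then show False using card assms(2) by simp
  qed
  then have iso: "no_isolated G" and ne: "pverts G \<noteq> {}"
    by (auto simp: no_isolated_def arcs) metis
  note H = iterated_mycielskian[OF graph iso diam ne, of t]
  obtain xs where "co_ham_path ?H xs"
    using co_ham_path_iterated_mycielskian[OF graph, of "t - 2"] assms(1)
    by (metis le_add_diff_inverse2)
  then have "L21_number ?H = card (pverts ?H) - 1"
    using H L21_number_eq_card by blast
  moreover have "card (pverts ?H) + 1 = 2 ^ t * (n + 1)"
    using H card by blast
  ultimately show ?thesis by linarith
qed

end
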